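(* Let $m$ be a positive integer, let $1<p_1,\ldots,p_m<\infty$, let $p$ be defined by $\frac1p=\sum_{i=1}^m\frac1{p_i}$, and write $\vec{p}=(p_1,\ldots,p_m)$. Let $\vec{w}=(w_1,\ldots,w_m)$ be a vector of weights on $\mathbb{R}^n$, and set $w=\prod_{i=1}^m w_i^{\frac{p}{p_i}}$ and $\sigma_i=w_i^{1-p_i'}$ for $1\le i\le m$. Then $\vec{w}\in A_{\vec{p}}$ if and only if $w,\sigma_1,\ldots,\sigma_m\in A_\infty$.
   Context: A weight is a measurable function on $\mathbb{R}^n$ that is positive and finite almost everywhere. All cubes have sides parallel to the coordinate axes; suprema below are over all cubes $Q\subset\mathbb{R}^n$. For $1<q<\infty$, $q'=\frac{q}{q-1}$. For $1<q<\infty$, a weight $v$ is in $A_q$ if $$[v]_{A_q}=\sup_Q\left(\frac{1}{|Q|}\int_Q v\,dx\right)\left(\frac{1}{|Q|}\int_Q v^{1-q'}\,dx\right)^{q-1}<\infty,$$ and $A_\infty=\bigcup_{1<q<\infty}A_q$. With $\vec{p}$, $p$, $\vec{w}$ and $w=\prod_{i=1}^m w_i^{\frac{p}{p_i}}$ as in the claim, $\vec{w}\in A_{\vec{p}}$ means $$[\vec{w}]_{A_{\vec{p}}}=\sup_Q\left(\frac{1}{|Q|}\int_Q w\,dx\right)^{\frac1p}\prod_{i=1}^m\left(\frac{1}{|Q|}\int_Q w_i^{1-p_i'}\,dx\right)^{\frac1{p_i'}}<\infty.$$ *)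

theory Defs
  imports "HOL-Analysis.Analysis"
begin

text \<open>Real powers of elements of \<^typ>\<open>ennreal\<close>, with the conventions
  \<open>0 ^ a = \<infinity>\<close> and \<open>\<infinity> ^ a = 0\<close> for \<open>a < 0\<close>, and \<open>x ^ 0 = 1\<close>.\<close>

definition epowr :: "ennreal \<Rightarrow> real \<Rightarrow> ennreal"  (infixr "epowr" 80) where
  "x epowr a =
     (if a = 0 then 1
      else if x = 0 then (if a < 0 then \<infinity> else 0)
      else if x = \<infinity> then (if a < 0 then 0 else \<infinity>)
      else ennreal (enn2real x powr a))"

definition conj_exp :: "real \<Rightarrow> real" where
  "conj_exp q = q / (q - 1)"

text \<open>Weights take values in \<open>[0, \<infinity>]\<close>, since they are required to be positive and finite only
  almost everywhere.\<close>

definition weight :: "(real ^ 'n \<Rightarrow> ennreal) \<Rightarrow> bool" where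
  "weight v \<longleftrightarrow> v \<in> borel_measurable lebesgue \<and> (AE x in lebesgue. 0 < v x \<and> v x < \<infinity>)"

definition cubes :: "(real ^ 'n) set set" where
  "cubes = {cbox a (\<chi> i. a $ i + l) |a l. 0 < l}"

definition avg :: "(real ^ 'n) set \<Rightarrow> (real ^ 'n \<Rightarrow> ennreal) \<Rightarrow> ennreal" where
  "avg Q f = (\<integral>\<^sup>+ x \<in> Q. f x \<partial>lebesgue) / emeasure lebesgue Q"

definition A_const :: "real \<Rightarrow> (real ^ 'n \<Rightarrow> ennreal) \<Rightarrow> ennreal" where
  "A_const q v =
     (SUP Q \<in> cubes. avg Q v * avg Q (\<lambda>x. v x epowr (1 - conj_exp q)) epowr (q - 1))"

definition A_class :: "real \<Rightarrow> (real ^ 'n \<Rightarrow> ennreal) set" where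
  "A_class q = {v. weight v \<and> A_const q v < \<infinity>}"

definition A_infinity :: "(real ^ 'n \<Rightarrow> ennreal) set" where
  "A_infinity = (\<Union>q \<in> {1<..}. A_class q)"

text \<open>A vector \<open>(x\<^sub>1, \<dots>, x\<^sub>m)\<close> is a function on \<^typ>\<open>nat\<close>, of which only the values on
  \<open>{1..m}\<close> matter.\<close>

definition joint_exp :: "nat \<Rightarrow> (nat \<Rightarrow> real) \<Rightarrow> real" where
  "joint_exp m ps = 1 / (\<Sum>i = 1..m. 1 / ps i)"

definition prod_weight ::
    "nat \<Rightarrow> (nat \<Rightarrow> real) \<Rightarrow> (nat \<Rightarrow> real ^ 'n \<Rightarrow> ennreal) \<Rightarrow> real ^ 'n \<Rightarrow> ennreal" where
  "prod_weight m ps ws x = (\<Prod>i = 1..m. ws i x epowr (joint_exp m ps / ps i))"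

definition A_vec_const ::
    "nat \<Rightarrow> (nat \<Rightarrow> real) \<Rightarrow> (nat \<Rightarrow> real ^ 'n \<Rightarrow> ennreal) \<Rightarrow> ennreal" where
  "A_vec_const m ps ws =
     (SUP Q \<in> cubes. avg Q (prod_weight m ps ws) epowr (1 / joint_exp m ps) *
        (\<Prod>i = 1..m. avg Q (\<lambda>x. ws i x epowr (1 - conj_exp (ps i))) epowr (1 / conj_exp (ps i))))"

definition A_vec ::
    "nat \<Rightarrow> (nat \<Rightarrow> real) \<Rightarrow> (nat \<Rightarrow> real ^ 'n \<Rightarrow> ennreal) set" where
  "A_vec m ps = {ws. (\<forall>i \<in> {1..m}. weight (ws i)) \<and> A_vec_const m ps ws < \<infinity>}"

end

theory Submission
  imports Defs
begin

text \<open>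
  Put \<open>u 0 = w\<close> and \<open>u i = \<sigma> i\<close> for \<open>1 \<le> i \<le> m\<close>, with exponents \<open>\<alpha> 0 = 1 / p\<close> and
  \<open>\<alpha> i = 1 / conj_exp (ps i)\<close>. Since \<open>w\<close> to the power \<open>1 / p\<close> is the product of the
  \<open>ws i\<close> to the powers \<open>1 / ps i\<close>, while \<open>\<sigma> i\<close> to the power \<open>\<alpha> i\<close> is \<open>ws i\<close> to the power
  \<open>- 1 / ps i\<close>, the product of all \<open>u i epowr \<alpha> i\<close> is \<open>1\<close> almost everywhere, and the constant of
  the multilinear class is the supremum over \<open>Q\<close> of the products of the \<open>avg Q (u i) epowr \<alpha> i\<close>.
  In this form \<open>w\<close> and the \<open>\<sigma> i\<close> play the same role, and the theorem becomes the statement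
  \<open>prod_avg_bounded_iff_A_infinity\<close> on any finite family of at least two weights whose powers
  multiply to \<open>1\<close>. Each direction is one application of Hoelder's inequality for several functions.

  If the products of averages are bounded, fix \<open>j\<close>. The power \<open>u j epowr (- \<alpha> j)\<close> is the product
  of the other \<open>u i epowr \<alpha> i\<close>, so Hoelder's inequality, with the exponents \<open>\<alpha> i\<close> normalised by
  their sum \<open>S\<close> over \<open>i \<noteq> j\<close>, bounds the average of \<open>u j epowr (- \<alpha> j / S)\<close> by the averages of
  the other \<open>u i\<close>. The bound obtained is the condition for \<open>u j\<close> to lie in
  \<open>A_class (1 + S / \<alpha> j)\<close>.

  Conversely, let \<open>u i\<close> lie in \<open>A_class (q i)\<close>, and let \<open>v i\<close> be the dual weight, the power
  \<open>- 1 / (q i - 1)\<close> of \<open>u i\<close>. Suitable powers of the \<open>v i\<close> also multiply to \<open>1\<close>, so Hoelder's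
  inequality for their product bounds \<open>1\<close> by a product of powers of the averages of the \<open>v i\<close>.
  This lower bound turns the upper bounds on \<open>avg Q (u i) * avg Q (v i) epowr (q i - 1)\<close> into an
  upper bound on the product of the powers of the \<open>avg Q (u i)\<close> alone.
\<close>

section \<open>Powers of extended nonnegative reals\<close>

lemma epowr_zero [simp]: "x epowr 0 = 1"
  by (simp add: epowr_def)

lemma one_epowr [simp]: "1 epowr a = 1"
  by (simp add: epowr_def)

lemma epowr_one [simp]: "x epowr 1 = x"
  by (auto simp: epowr_def less_top)

lemma ennreal_epowr: "0 < r \<Longrightarrow> ennreal r epowr a = ennreal (r powr a)"
  by (auto simp: epowr_def)

lemma pos_finite_ennreal_cases:
  assumes "0 < x" "x < (\<infinity> :: ennreal)"
  obtains r where "0 < r" "x = ennreal r"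
  using assms by (cases x) (auto simp: ennreal_eq_0_iff)

lemma epowr_pos_finite:
  assumes "0 < x" "x < \<infinity>"
  shows "0 < x epowr a" "x epowr a < \<infinity>"
  using assms by (auto elim!: pos_finite_ennreal_cases simp: ennreal_epowr)

lemma epowr_eq_0_iff: "0 < a \<Longrightarrow> x epowr a = 0 \<longleftrightarrow> x = 0"
  by (cases x) (auto simp: epowr_def ennreal_eq_0_iff)

lemma epowr_eq_top_iff: "0 < a \<Longrightarrow> x epowr a = \<infinity> \<longleftrightarrow> x = \<infinity>"
  by (auto simp: epowr_def)

lemma epowr_epowr: "(x epowr a) epowr b = x epowr (a * b)"
proof (cases "x = 0 \<or> x = \<infinity>")
  case True
  then show ?thesis
    by (auto simp: epowr_def mult_less_0_iff zero_less_mult_iff)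
next
  case False
  then obtain r where "0 < r" "x = ennreal r"
    by (metis pos_finite_ennreal_cases infinity_ennreal_def less_top not_gr_zero)
  then show ?thesis
    by (simp add: ennreal_epowr powr_powr)
qed

lemma epowr_add:
  assumes "0 < x" "x < \<infinity>"
  shows "x epowr (a + b) = x epowr a * x epowr b"
  using assms by (auto elim!: pos_finite_ennreal_cases simp: ennreal_epowr powr_add ennreal_mult)

lemma epowr_mono:
  assumes "0 \<le> a" "x \<le> y"
  shows "x epowr a \<le> y epowr a"
proof (cases "a = 0 \<or> x = 0 \<or> y = \<infinity>")
  case True
  then show ?thesis
    using assms by (auto simp: epowr_def)
next
  case False
  with assms have "x \<noteq> \<infinity>" "y \<noteq> 0"
    by (auto simp: top_unique)
  with False assms show ?thesis
    by (cases x; cases y) (auto simp: epowr_def intro!: powr_mono2)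
qed

text \<open>The sign condition is needed: for \<open>a < 0\<close>, \<open>x = 0\<close> and \<open>y = \<infinity>\<close> the left-hand side is
  \<open>0 epowr a = \<infinity>\<close>, but the right-hand side is \<open>\<infinity> * 0 = 0\<close>. Powers with negative exponents can
  be multiplied only away from \<open>0\<close> and \<open>\<infinity>\<close>, as in \<open>epowr_prod_pos_finite\<close>.\<close>

lemma epowr_mult:
  assumes "0 \<le> a"
  shows "(x * y) epowr a = x epowr a * y epowr a"
proof (cases "x = 0 \<or> y = 0 \<or> x = \<infinity> \<or> y = \<infinity> \<or> a = 0")
  case True
  with assms show ?thesis
    by (auto simp: epowr_def ennreal_mult_eq_top_iff ennreal_top_mult ennreal_mult_top
        enn2real_eq_0_iff)
next
  case False
  then obtain r s where "0 < r" "x = ennreal r" "0 < s" "y = ennreal s"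
    by (metis pos_finite_ennreal_cases infinity_ennreal_def less_top not_gr_zero)
  then show ?thesis
    by (simp add: ennreal_epowr powr_mult flip: ennreal_mult)
qed

lemma epowr_prod:
  assumes "0 \<le> a"
  shows "(\<Prod>i\<in>I. x i) epowr a = (\<Prod>i\<in>I. x i epowr a)"
  by (induction I rule: infinite_finite_induct) (simp_all add: epowr_mult assms)

lemma epowr_prod_pos_finite:
  assumes "\<And>i. i \<in> I \<Longrightarrow> 0 < x i \<and> x i < \<infinity>"
  shows "(\<Prod>i\<in>I. x i) epowr a = (\<Prod>i\<in>I. x i epowr a)"
proof -
  have x: "x i = ennreal (enn2real (x i))" "0 < enn2real (x i)" if "i \<in> I" for i
    using assms[OF that] by (auto simp: enn2real_positive_iff)
  have "(\<Prod>i\<in>I. x i) = ennreal (\<Prod>i\<in>I. enn2real (x i))"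
    using x by (simp flip: prod_ennreal)
  moreover have "(\<Prod>i\<in>I. x i epowr a) = ennreal (\<Prod>i\<in>I. enn2real (x i) powr a)"
    using x by (subst prod_ennreal[symmetric]) (auto simp flip: ennreal_epowr)
  ultimately show ?thesis
    using x by (simp add: ennreal_epowr prod_pos prod_powr_distrib less_imp_le)
qed

lemma borel_measurable_epowr [measurable]:
  assumes [measurable]: "f \<in> borel_measurable M"
  shows "(\<lambda>x. f x epowr a) \<in> borel_measurable M"
  unfolding epowr_def by measurable

section \<open>Hoelder's inequality for finitely many functions\<close>

text \<open>This is Jensen's inequality for the exponential function at the points \<open>ln (x i)\<close>.\<close>

lemma weighted_arith_geom_mean:
  fixes x \<theta> :: "'i \<Rightarrow> real"
  assumes "finite I" and "\<And>i. i \<in> I \<Longrightarrow> 0 < x i" and "\<And>i. i \<in> I \<Longrightarrow> 0 \<le> \<theta> i" and "sum \<theta> I = 1"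
  shows "(\<Prod>i\<in>I. x i powr \<theta> i) \<le> (\<Sum>i\<in>I. \<theta> i * x i)"
proof -
  have "I \<noteq> {}"
    using assms(4) by auto
  have "(\<Prod>i\<in>I. x i powr \<theta> i) = exp (\<Sum>i\<in>I. \<theta> i *\<^sub>R ln (x i))"
    using assms(1) by (force simp: exp_sum powr_def dest: assms(2) intro!: prod.cong)
  also have "\<dots> \<le> (\<Sum>i\<in>I. \<theta> i * exp (ln (x i)))"
    by (rule convex_on_sum[OF assms(1) \<open>I \<noteq> {}\<close> exp_convex]) (use assms in auto)
  also have "\<dots> = (\<Sum>i\<in>I. \<theta> i * x i)"
    using assms(2) by simp
  finally show ?thesis .
qed

text \<open>Strict positivity of the \<open>\<theta> i\<close> settles the degenerate cases: a vanishing \<open>x i\<close> makes the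
  left-hand side \<open>0\<close>, and an infinite one makes the right-hand side \<open>\<infinity>\<close>.\<close>

lemma weighted_arith_geom_mean_ennreal:
  fixes x :: "'i \<Rightarrow> ennreal" and \<theta> :: "'i \<Rightarrow> real"
  assumes "finite I" and \<theta>: "\<And>i. i \<in> I \<Longrightarrow> 0 < \<theta> i" and "sum \<theta> I = 1"
  shows "(\<Prod>i\<in>I. x i epowr \<theta> i) \<le> (\<Sum>i\<in>I. ennreal (\<theta> i) * x i)"
proof -
  consider (zero) "\<exists>i\<in>I. x i = 0" | (infinite) "\<exists>i\<in>I. x i = \<infinity>"
    | (real) "\<And>i. i \<in> I \<Longrightarrow> 0 < x i \<and> x i < \<infinity>"
    by (metis infinity_ennreal_def less_top not_gr_zero)
  then show ?thesis
  proof cases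
    case zero
    then have "(\<Prod>i\<in>I. x i epowr \<theta> i) = 0"
      using assms(1) \<theta> by (auto simp: epowr_eq_0_iff)
    then show ?thesis
      by (simp del: ennreal_prod_eq_0)
  next
    case infinite
    then obtain i where i: "i \<in> I" "x i = \<infinity>"
      by blast
    then have "ennreal (\<theta> i) * x i = \<infinity>"
      using \<theta>[of i] by (simp add: ennreal_mult_top)
    then have "(\<Sum>i\<in>I. ennreal (\<theta> i) * x i) = \<infinity>"
      using assms(1) i(1) by auto
    then show ?thesis
      by simp
  next
    case real
    define r where "r = enn2real \<circ> x"
    have r: "x i = ennreal (r i)" "0 < r i" if "i \<in> I" for i
      using real[OF that] by (auto simp: enn2real_positive_iff r_def)
    have "(\<Prod>i\<in>I. x i epowr \<theta> i) = ennreal (\<Prod>i\<in>I. r i powr \<theta> i)"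
      by (subst prod_ennreal[symmetric]) (auto simp: r ennreal_epowr)
    also have "\<dots> \<le> ennreal (\<Sum>i\<in>I. \<theta> i * r i)"
      by (intro ennreal_leI weighted_arith_geom_mean)
        (use assms r \<theta> in \<open>auto simp: less_imp_le\<close>)
    also have "\<dots> = (\<Sum>i\<in>I. ennreal (\<theta> i) * x i)"
      by (subst sum_ennreal[symmetric]) (auto simp: r ennreal_mult \<theta> less_imp_le)
    finally show ?thesis .
  qed
qed

text \<open>After division of each \<open>f i\<close> by its integral, the inequality is the integral of the pointwise
  inequality between the weighted means. The normalisation fails only if some integral is \<open>0\<close>, when
  the integrand on the left vanishes almost everywhere, or if some integral is \<open>\<infinity>\<close> and none is
  \<open>0\<close>, when the right-hand side is \<open>\<infinity>\<close>.\<close>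

lemma Hoelder_nn_integral_prod:
  fixes f :: "'i \<Rightarrow> 'a \<Rightarrow> ennreal" and \<theta> :: "'i \<Rightarrow> real"
  assumes "finite I" and \<theta>: "\<And>i. i \<in> I \<Longrightarrow> 0 < \<theta> i" "sum \<theta> I = 1"
    and f [measurable]: "\<And>i. i \<in> I \<Longrightarrow> f i \<in> borel_measurable M"
  shows "(\<integral>\<^sup>+x. (\<Prod>i\<in>I. f i x epowr \<theta> i) \<partial>M) \<le> (\<Prod>i\<in>I. (\<integral>\<^sup>+x. f i x \<partial>M) epowr \<theta> i)"
proof -
  define A where "A i = (\<integral>\<^sup>+x. f i x \<partial>M)" for i
  consider (zero) "\<exists>i\<in>I. A i = 0" | (infinite) "\<forall>i\<in>I. A i \<noteq> 0" "\<exists>i\<in>I. A i = \<infinity>"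
    | (real) "\<And>i. i \<in> I \<Longrightarrow> 0 < A i \<and> A i < \<infinity>"
    by (metis infinity_ennreal_def less_top not_gr_zero)
  then have "(\<integral>\<^sup>+x. (\<Prod>i\<in>I. f i x epowr \<theta> i) \<partial>M) \<le> (\<Prod>i\<in>I. A i epowr \<theta> i)"
  proof cases
    case zero
    then obtain j where j: "j \<in> I" "A j = 0"
      by blast
    then have "AE x in M. f j x = 0"
      using f unfolding A_def by (subst (asm) nn_integral_0_iff_AE) auto
    then have "AE x in M. (\<Prod>i\<in>I. f i x epowr \<theta> i) = 0"
      by eventually_elim (use j assms(1) \<theta> epowr_eq_0_iff in auto)
    then have "(\<integral>\<^sup>+x. (\<Prod>i\<in>I. f i x epowr \<theta> i) \<partial>M) = (\<integral>\<^sup>+x. 0 \<partial>M)"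
      by (rule nn_integral_cong_AE)
    then show ?thesis
      by simp
  next
    case infinite
    then have "(\<Prod>i\<in>I. A i epowr \<theta> i) = \<infinity>"
      using assms(1) \<theta> epowr_eq_0_iff epowr_eq_top_iff
      by (auto simp: ennreal_prod_eq_top)
    then show ?thesis
      by simp
  next
    case real
    have "f i x = A i * (f i x / A i)" if "i \<in> I" for i x
      using real[OF that]
      by (metis ennreal_times_divide infinity_ennreal_def mult.commute mult_divide_eq_ennreal
          order_less_irrefl)
    then have "(\<integral>\<^sup>+x. (\<Prod>i\<in>I. f i x epowr \<theta> i) \<partial>M)
        = (\<integral>\<^sup>+x. (\<Prod>i\<in>I. (A i * (f i x / A i)) epowr \<theta> i) \<partial>M)"
      by (metis (no_types, lifting) prod.cong)
    also have "\<dots> = (\<integral>\<^sup>+x. (\<Prod>i\<in>I. A i epowr \<theta> i) * (\<Prod>i\<in>I. (f i x / A i) epowr \<theta> i) \<partial>M)"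
      by (simp add: epowr_mult \<theta> less_imp_le prod.distrib)
    also have "\<dots> = (\<Prod>i\<in>I. A i epowr \<theta> i) * (\<integral>\<^sup>+x. (\<Prod>i\<in>I. (f i x / A i) epowr \<theta> i) \<partial>M)"
      by (rule nn_integral_cmult) measurable
    also have "(\<integral>\<^sup>+x. (\<Prod>i\<in>I. (f i x / A i) epowr \<theta> i) \<partial>M)
        \<le> (\<integral>\<^sup>+x. (\<Sum>i\<in>I. ennreal (\<theta> i) * (f i x / A i)) \<partial>M)"
      by (intro nn_integral_mono weighted_arith_geom_mean_ennreal assms)
    also have "\<dots> = (\<Sum>i\<in>I. ennreal (\<theta> i) * (A i / A i))"
      by (subst nn_integral_sum) (auto simp: nn_integral_cmult nn_integral_divide A_def)
    also have "\<dots> = (\<Sum>i\<in>I. ennreal (\<theta> i))"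
      using real by (intro sum.cong) (simp_all add: order_less_imp_not_eq2)
    also have "\<dots> = 1"
      using \<theta> by (simp add: sum_ennreal less_imp_le)
    finally show ?thesis
      by (simp add: mult_left_mono)
  qed
  then show ?thesis
    by (simp add: A_def)
qed

section \<open>Averages over cubes\<close>

lemma cube_measure:
  assumes "Q \<in> cubes"
  shows "Q \<in> sets lebesgue" "emeasure lebesgue Q \<noteq> 0" "emeasure lebesgue Q \<noteq> \<infinity>"
proof -
  obtain a and l :: real where Q: "Q = cbox a (\<chi> i. a $ i + l)" "0 < l"
    using assms by (auto simp: cubes_def)
  then show "Q \<in> sets lebesgue" "emeasure lebesgue Q \<noteq> \<infinity>"
    by (auto simp: emeasure_lborel_cbox_eq)
  have "emeasure lebesgue Q = ennreal (\<Prod>b\<in>Basis. ((\<chi> i. a $ i + l) - a) \<bullet> b)"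
    using Q by (auto simp: emeasure_lborel_cbox_eq Basis_vec_def inner_axis)
  moreover have "0 < (\<Prod>b\<in>Basis. ((\<chi> i. a $ i + l) - a) \<bullet> b)"
    using Q(2) by (intro prod_pos) (auto simp: Basis_vec_def inner_axis)
  ultimately show "emeasure lebesgue Q \<noteq> 0"
    by (simp add: ennreal_eq_0_iff)
qed

lemma avg_eq_uniform_measure:
  assumes "Q \<in> cubes" "f \<in> borel_measurable lebesgue"
  shows "avg Q f = (\<integral>\<^sup>+x. f x \<partial>uniform_measure lebesgue Q)"
  using assms(2) cube_measure[OF assms(1)] by (simp add: avg_def nn_integral_uniform_measure)

lemma avg_cong_AE:
  assumes "AE x in lebesgue. f x = g x"
  shows "avg Q f = avg Q g"
proof -
  have "(\<integral>\<^sup>+ x \<in> Q. f x \<partial>lebesgue) = (\<integral>\<^sup>+ x \<in> Q. g x \<partial>lebesgue)"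
    by (rule nn_integral_cong_AE) (use assms in auto)
  then show ?thesis
    by (simp add: avg_def)
qed

lemma avg_one: "Q \<in> cubes \<Longrightarrow> avg Q (\<lambda>x. 1) = 1"
  using cube_measure[of Q] by (simp add: avg_def ennreal_divide_self less_top)

lemma avg_Hoelder:
  assumes "Q \<in> cubes" "finite I" "\<And>i. i \<in> I \<Longrightarrow> 0 < \<theta> i" "sum \<theta> I = 1"
    and [measurable]: "\<And>i. i \<in> I \<Longrightarrow> f i \<in> borel_measurable lebesgue"
  shows "avg Q (\<lambda>x. \<Prod>i\<in>I. f i x epowr \<theta> i) \<le> (\<Prod>i\<in>I. avg Q (f i) epowr \<theta> i)"
proof -
  have "avg Q (\<lambda>x. \<Prod>i\<in>I. f i x epowr \<theta> i)
      = (\<integral>\<^sup>+x. (\<Prod>i\<in>I. f i x epowr \<theta> i) \<partial>uniform_measure lebesgue Q)"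
    by (rule avg_eq_uniform_measure[OF assms(1)]) measurable
  also have "\<dots> \<le> (\<Prod>i\<in>I. (\<integral>\<^sup>+x. f i x \<partial>uniform_measure lebesgue Q) epowr \<theta> i)"
  proof (rule Hoelder_nn_integral_prod)
    show "f i \<in> borel_measurable (uniform_measure lebesgue Q)" if "i \<in> I" for i
      using that by measurable
  qed (use assms in auto)
  also have "\<dots> = (\<Prod>i\<in>I. avg Q (f i) epowr \<theta> i)"
    by (intro prod.cong) (simp_all add: avg_eq_uniform_measure assms)
  finally show ?thesis .
qed

section \<open>Families of weights with trivial weighted product\<close>

lemma one_minus_conj_exp: "q \<noteq> 1 \<Longrightarrow> 1 - conj_exp q = - (1 / (q - 1))"
  by (simp add: conj_exp_def field_simps)

lemma weight_epowr:
  assumes "weight v"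
  shows "weight (\<lambda>x. v x epowr a)"
proof -
  have [measurable]: "v \<in> borel_measurable lebesgue" and "AE x in lebesgue. 0 < v x \<and> v x < \<infinity>"
    using assms by (auto simp: weight_def)
  from this(2) have "AE x in lebesgue. 0 < v x epowr a \<and> v x epowr a < \<infinity>"
    by eventually_elim (auto dest: epowr_pos_finite)
  then show ?thesis
    by (auto simp: weight_def)
qed

lemma prod_pos_finite_ennreal:
  fixes x :: "'i \<Rightarrow> ennreal"
  assumes "\<And>i. i \<in> I \<Longrightarrow> 0 < x i \<and> x i < \<infinity>"
  shows "0 < (\<Prod>i\<in>I. x i)" "(\<Prod>i\<in>I. x i) < \<infinity>"
  using assms
  by (auto simp: ennreal_prod_eq_top less_top[symmetric] zero_less_iff_neq_zero)

lemma weight_prod: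
  assumes "finite I" "\<And>i. i \<in> I \<Longrightarrow> weight (v i)"
  shows "weight (\<lambda>x. \<Prod>i\<in>I. v i x)"
proof -
  have [measurable]: "\<And>i. i \<in> I \<Longrightarrow> v i \<in> borel_measurable lebesgue"
    and "\<forall>i\<in>I. AE x in lebesgue. 0 < v i x \<and> v i x < \<infinity>"
    using assms(2) by (auto simp: weight_def)
  then have "AE x in lebesgue. \<forall>i\<in>I. 0 < v i x \<and> v i x < \<infinity>"
    using assms(1) by (simp add: AE_finite_all)
  then have "AE x in lebesgue. 0 < (\<Prod>i\<in>I. v i x) \<and> (\<Prod>i\<in>I. v i x) < \<infinity>"
    by eventually_elim (intro conjI prod_pos_finite_ennreal; blast)
  then show ?thesis
    unfolding weight_def by simp
qed

text \<open>The weight \<open>u j\<close> is tied to the others by \<open>u j epowr (- \<alpha> j)\<close> being the product of their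
  powers, so that averages of a negative power of \<open>u j\<close> are controlled by the averages of the other
  weights. A second index guarantees that the exponents of the other weights have a positive sum.\<close>

lemma prod_avg_bounded_imp_A_infinity:
  assumes "finite I" "j \<in> I" "I \<noteq> {j}"
    and \<alpha>: "\<And>i. i \<in> I \<Longrightarrow> 0 < \<alpha> i"
    and u: "\<And>i. i \<in> I \<Longrightarrow> weight (u i)"
    and one: "AE x in lebesgue. (\<Prod>i\<in>I. u i x epowr \<alpha> i) = 1"
    and K: "K < \<infinity>" "\<And>Q. Q \<in> cubes \<Longrightarrow> (\<Prod>i\<in>I. avg Q (u i) epowr \<alpha> i) \<le> K"
  shows "u j \<in> A_infinity"
proof -
  define J where "J = I - {j}"
  have J: "finite J" "J \<noteq> {}" "J \<subseteq> I" and I: "I = insert j J" "j \<notin> J"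
    using assms(1-3) by (auto simp: J_def)
  define S where "S = sum \<alpha> J"
  have "0 < S"
    unfolding S_def using J \<alpha> by (intro sum_pos) auto
  have "0 < \<alpha> j"
    using \<alpha> assms(2) .
  \<comment> \<open>Hoelder's inequality for the weights other than \<open>u j\<close> uses the exponents \<open>\<alpha> i / S\<close>, which sum
    to \<open>1\<close>, and so yields the power \<open>- \<alpha> j / S\<close> of \<open>u j\<close>; this \<open>q\<close> has it as \<open>1 - conj_exp q\<close>.\<close>
  define q where "q = 1 + S / \<alpha> j"
  have q: "1 < q" and conj: "1 - conj_exp q = - (\<alpha> j / S)"
    using \<open>0 < S\<close> \<open>0 < \<alpha> j\<close> by (auto simp: q_def one_minus_conj_exp)
  have [measurable]: "\<And>i. i \<in> I \<Longrightarrow> u i \<in> borel_measurable lebesgue"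
    using u by (auto simp: weight_def)
  have "AE x in lebesgue. 0 < u j x \<and> u j x < \<infinity>"
    using u[OF assms(2)] by (simp add: weight_def)
  with one have dual: "AE x in lebesgue. u j x epowr (1 - conj_exp q) = (\<Prod>i\<in>J. u i x epowr (\<alpha> i / S))"
  proof eventually_elim
    case (elim x)
    then have "u j x epowr (- \<alpha> j) = u j x epowr (- \<alpha> j) * (u j x epowr \<alpha> j * (\<Prod>i\<in>J. u i x epowr \<alpha> i))"
      using I J by simp
    also have "\<dots> = (u j x epowr (- \<alpha> j) * u j x epowr \<alpha> j) * (\<Prod>i\<in>J. u i x epowr \<alpha> i)"
      by (simp add: mult.assoc)
    also have "u j x epowr (- \<alpha> j) * u j x epowr \<alpha> j = 1"
      using elim by (simp flip: epowr_add)
    finally have "(u j x epowr (- \<alpha> j)) epowr (1 / S) = (\<Prod>i\<in>J. u i x epowr \<alpha> i) epowr (1 / S)"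
      by simp
    then show ?case
      using \<open>0 < S\<close> by (simp add: epowr_epowr epowr_prod conj)
  qed
  have "avg Q (u j) * avg Q (\<lambda>x. u j x epowr (1 - conj_exp q)) epowr (q - 1) \<le> K epowr (1 / \<alpha> j)"
    if Q: "Q \<in> cubes" for Q
  proof -
    have "avg Q (\<lambda>x. u j x epowr (1 - conj_exp q)) = avg Q (\<lambda>x. \<Prod>i\<in>J. u i x epowr (\<alpha> i / S))"
      using dual by (rule avg_cong_AE)
    also have "\<dots> \<le> (\<Prod>i\<in>J. avg Q (u i) epowr (\<alpha> i / S))"
      using \<open>0 < S\<close> J \<alpha>
      by (intro avg_Hoelder Q) (auto simp: S_def simp flip: sum_divide_distrib)
    finally have "avg Q (\<lambda>x. u j x epowr (1 - conj_exp q)) epowr (q - 1)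
        \<le> (\<Prod>i\<in>J. avg Q (u i) epowr (\<alpha> i / S)) epowr (q - 1)"
      using q by (intro epowr_mono) auto
    also have "\<dots> = (\<Prod>i\<in>J. avg Q (u i) epowr \<alpha> i) epowr (1 / \<alpha> j)"
      using \<open>0 < S\<close> \<open>0 < \<alpha> j\<close> by (simp add: epowr_prod epowr_epowr q_def)
    finally have "avg Q (u j) * avg Q (\<lambda>x. u j x epowr (1 - conj_exp q)) epowr (q - 1)
        \<le> avg Q (u j) * (\<Prod>i\<in>J. avg Q (u i) epowr \<alpha> i) epowr (1 / \<alpha> j)"
      by (rule mult_left_mono) simp
    also have "\<dots> = (\<Prod>i\<in>I. avg Q (u i) epowr \<alpha> i) epowr (1 / \<alpha> j)"
      using I J \<open>0 < \<alpha> j\<close> by (simp add: epowr_mult epowr_epowr)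
    also have "\<dots> \<le> K epowr (1 / \<alpha> j)"
      using K(2)[OF Q] \<open>0 < \<alpha> j\<close> by (intro epowr_mono) auto
    finally show ?thesis .
  qed
  then have "A_const q (u j) \<le> K epowr (1 / \<alpha> j)"
    unfolding A_const_def by (rule SUP_least)
  also have "\<dots> < \<infinity>"
    using K(1) \<open>0 < \<alpha> j\<close> epowr_eq_top_iff[of "1 / \<alpha> j" K] by (simp add: less_top[symmetric])
  finally show ?thesis
    using q u[OF assms(2)] by (auto simp: A_infinity_def A_class_def)
qed

text \<open>Multiplying the \<open>A_class\<close> bounds for the \<open>u i\<close>, each raised to the power \<open>\<alpha> i\<close>, bounds the
  product of the averages of the \<open>u i\<close> times a product of averages of dual weights. The second
  factor is at least \<open>1\<close>, because powers of the dual weights multiply to \<open>1\<close> almost everywhere. The classes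
  may differ from weight to weight, since the Hoelder exponents can be adapted to the \<open>q i\<close>.\<close>

lemma A_infinity_imp_prod_avg_bounded:
  assumes "finite I" "I \<noteq> {}"
    and \<alpha>: "\<And>i. i \<in> I \<Longrightarrow> 0 < \<alpha> i"
    and u: "\<And>i. i \<in> I \<Longrightarrow> u i \<in> A_infinity"
    and one: "AE x in lebesgue. (\<Prod>i\<in>I. u i x epowr \<alpha> i) = 1"
  obtains K where "K < \<infinity>" "\<And>Q. Q \<in> cubes \<Longrightarrow> (\<Prod>i\<in>I. avg Q (u i) epowr \<alpha> i) \<le> K"
proof -
  have "\<forall>i\<in>I. \<exists>q>1. u i \<in> A_class q"
    using u by (auto simp: A_infinity_def)
  then obtain q where q: "\<And>i. i \<in> I \<Longrightarrow> 1 < q i" "\<And>i. i \<in> I \<Longrightarrow> u i \<in> A_class (q i)"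
    by metis
  then have [measurable]: "\<And>i. i \<in> I \<Longrightarrow> u i \<in> borel_measurable lebesgue"
    and pos: "\<forall>i\<in>I. AE x in lebesgue. 0 < u i x \<and> u i x < \<infinity>"
    by (auto simp: A_class_def weight_def)
  define T where "T = (\<Sum>i\<in>I. \<alpha> i * (q i - 1))"
  have "0 < T"
    unfolding T_def using assms(1,2) \<alpha> q by (intro sum_pos) auto
  \<comment> \<open>The factor \<open>q i - 1\<close> cancels the exponent of the dual weight: \<open>v i epowr \<theta> i\<close> below is
    \<open>u i epowr (- \<alpha> i / T)\<close>, and \<open>T\<close> normalises the sum of the \<open>\<theta> i\<close>.\<close>
  define \<theta> where "\<theta> i = \<alpha> i * (q i - 1) / T" for i
  have \<theta>: "\<And>i. i \<in> I \<Longrightarrow> 0 < \<theta> i" "sum \<theta> I = 1"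
    using \<alpha> q \<open>0 < T\<close> by (auto simp: \<theta>_def T_def simp flip: sum_divide_distrib)
  define v where "v i x = u i x epowr (1 - conj_exp (q i))" for i x
  have exponent: "(1 - conj_exp (q i)) * \<theta> i = \<alpha> i * - (1 / T)" if "i \<in> I" for i
    using q(1)[OF that] by (simp add: one_minus_conj_exp \<theta>_def)
  have "AE x in lebesgue. \<forall>i\<in>I. 0 < u i x \<and> u i x < \<infinity>"
    using assms(1) pos by (simp add: AE_finite_all)
  with one have v_one: "AE x in lebesgue. (\<Prod>i\<in>I. v i x epowr \<theta> i) = 1"
  proof eventually_elim
    case (elim x)
    have "(\<Prod>i\<in>I. v i x epowr \<theta> i) = (\<Prod>i\<in>I. (u i x epowr \<alpha> i) epowr - (1 / T))"
      by (intro prod.cong) (simp_all add: v_def epowr_epowr exponent)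
    also have "\<dots> = (\<Prod>i\<in>I. u i x epowr \<alpha> i) epowr - (1 / T)"
      using elim by (intro epowr_prod_pos_finite[symmetric] conjI epowr_pos_finite) auto
    finally show ?case
      using elim by simp
  qed
  define K where "K = (\<Prod>i\<in>I. A_const (q i) (u i) epowr \<alpha> i)"
  have "(\<Prod>i\<in>I. avg Q (u i) epowr \<alpha> i) \<le> K" if Q: "Q \<in> cubes" for Q
  proof -
    have "1 = avg Q (\<lambda>x. \<Prod>i\<in>I. v i x epowr \<theta> i)"
      using avg_cong_AE[OF v_one] avg_one[OF Q] by simp
    also have "\<dots> \<le> (\<Prod>i\<in>I. avg Q (v i) epowr \<theta> i)"
      using assms(1) \<theta> by (intro avg_Hoelder Q) (auto simp: v_def)
    finally have "1 epowr T \<le> (\<Prod>i\<in>I. avg Q (v i) epowr \<theta> i) epowr T"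
      using \<open>0 < T\<close> by (intro epowr_mono) auto
    also have "\<dots> = (\<Prod>i\<in>I. (avg Q (v i) epowr (q i - 1)) epowr \<alpha> i)"
      using \<open>0 < T\<close> by (simp add: epowr_prod epowr_epowr \<theta>_def mult.commute)
    finally have "(\<Prod>i\<in>I. avg Q (u i) epowr \<alpha> i) * 1
        \<le> (\<Prod>i\<in>I. avg Q (u i) epowr \<alpha> i) * (\<Prod>i\<in>I. (avg Q (v i) epowr (q i - 1)) epowr \<alpha> i)"
      by (intro mult_left_mono) auto
    also have "\<dots> = (\<Prod>i\<in>I. (avg Q (u i) * avg Q (v i) epowr (q i - 1)) epowr \<alpha> i)"
      using \<alpha> by (simp add: epowr_mult less_imp_le flip: prod.distrib)
    also have "\<dots> \<le> K"
      unfolding K_def A_const_def v_def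
      by (intro prod_mono_ennreal epowr_mono SUP_upper Q) (use \<alpha> in \<open>auto simp: less_imp_le\<close>)
    finally show ?thesis
      by simp
  qed
  moreover have "K < \<infinity>"
  proof -
    have "A_const (q i) (u i) epowr \<alpha> i \<noteq> \<infinity>" if "i \<in> I" for i
      using q(2)[OF that] \<alpha>[OF that] epowr_eq_top_iff[of "\<alpha> i" "A_const (q i) (u i)"]
      by (auto simp: A_class_def)
    then show ?thesis
      by (auto simp: K_def ennreal_prod_eq_top less_top[symmetric])
  qed
  ultimately show thesis
    using that by blast
qed

theorem prod_avg_bounded_iff_A_infinity:
  assumes "finite I" "2 \<le> card I"
    and \<alpha>: "\<And>i. i \<in> I \<Longrightarrow> 0 < \<alpha> i"
    and u: "\<And>i. i \<in> I \<Longrightarrow> weight (u i)"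
    and one: "AE x in lebesgue. (\<Prod>i\<in>I. u i x epowr \<alpha> i) = 1"
  shows "(SUP Q \<in> cubes. \<Prod>i\<in>I. avg Q (u i) epowr \<alpha> i) < \<infinity> \<longleftrightarrow> (\<forall>i\<in>I. u i \<in> A_infinity)"
    (is "?K < \<infinity> \<longleftrightarrow> _")
proof
  assume K: "?K < \<infinity>"
  show "\<forall>i\<in>I. u i \<in> A_infinity"
  proof
    fix j
    assume "j \<in> I"
    moreover have "I \<noteq> {j}"
      using assms(2) by auto
    ultimately show "u j \<in> A_infinity"
      using K by (intro prod_avg_bounded_imp_A_infinity[OF assms(1) _ _ \<alpha> u one K] SUP_upper)
  qed
next
  assume "\<forall>i\<in>I. u i \<in> A_infinity"
  moreover have "I \<noteq> {}"
    using assms(2) by auto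
  ultimately obtain K where "K < \<infinity>" "\<And>Q. Q \<in> cubes \<Longrightarrow> (\<Prod>i\<in>I. avg Q (u i) epowr \<alpha> i) \<le> K"
    using A_infinity_imp_prod_avg_bounded[OF assms(1) _ \<alpha> _ one] by metis
  then show "?K < \<infinity>"
    by (meson SUP_least le_less_trans)
qed

section \<open>The multilinear class\<close>

text \<open>It remains to recognise \<open>w\<close> and the \<open>\<sigma> i\<close> as a family whose powers multiply to \<open>1\<close>; the
  index \<open>0\<close>, free in the numbering from \<open>1\<close>, is given to \<open>w\<close>.\<close>

theorem theorem1p8:
  fixes m :: nat
    and ps :: "nat \<Rightarrow> real"
    and p :: real
    and ws :: "nat \<Rightarrow> real ^ 'n \<Rightarrow> ennreal"
    and w :: "real ^ 'n \<Rightarrow> ennreal"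
    and \<sigma> :: "nat \<Rightarrow> real ^ 'n \<Rightarrow> ennreal"
  assumes "0 < m"
    and "\<And>i. i \<in> {1..m} \<Longrightarrow> 1 < ps i"
    and "1 / p = (\<Sum>i = 1..m. 1 / ps i)"
    and "\<And>i. i \<in> {1..m} \<Longrightarrow> weight (ws i)"
    and "\<And>x. w x = (\<Prod>i = 1..m. ws i x epowr (p / ps i))"
    and "\<And>i x. i \<in> {1..m} \<Longrightarrow> \<sigma> i x = ws i x epowr (1 - conj_exp (ps i))"
  shows "ws \<in> A_vec m ps \<longleftrightarrow> w \<in> A_infinity \<and> (\<forall>i \<in> {1..m}. \<sigma> i \<in> A_infinity)"
proof -
  have "0 < (\<Sum>i = 1..m. 1 / ps i)"
    using assms(1) by (intro sum_pos) (use assms(2) in force)+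
  then have "0 < p"
    using assms(3) by (metis zero_less_divide_1_iff)
  have joint: "joint_exp m ps = p"
    unfolding joint_exp_def assms(3)[symmetric] by simp
  have w_eq: "prod_weight m ps ws = w"
    by (rule ext) (simp add: prod_weight_def joint assms(5))
  have \<sigma>_eq: "\<sigma> i = (\<lambda>x. ws i x epowr (1 - conj_exp (ps i)))" if "i \<in> {1..m}" for i
    using assms(6)[OF that] by (rule ext)
  define u where "u i = (if i = 0 then w else \<sigma> i)" for i
  define \<alpha> where "\<alpha> i = (if i = 0 then 1 / p else 1 / conj_exp (ps i))" for i
  have index: "{0..m} = insert 0 {1..m}"
    by auto
  have split: "(\<Prod>i = 0..m. F (u i) (\<alpha> i))
      = F w (1 / p) * (\<Prod>i = 1..m. F (\<sigma> i) (1 / conj_exp (ps i)))"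
    for F :: "(real ^ 'n \<Rightarrow> ennreal) \<Rightarrow> real \<Rightarrow> ennreal"
    unfolding index by (simp add: u_def \<alpha>_def)
  have "ws \<in> A_vec m ps \<longleftrightarrow> A_vec_const m ps ws < \<infinity>"
    using assms(4) by (simp add: A_vec_def)
  also have "A_vec_const m ps ws
      = (SUP Q \<in> cubes. avg Q w epowr (1 / p) * (\<Prod>i = 1..m. avg Q (\<sigma> i) epowr (1 / conj_exp (ps i))))"
    unfolding A_vec_const_def w_eq joint by (simp add: \<sigma>_eq)
  also have "\<dots> = (SUP Q \<in> cubes. \<Prod>i = 0..m. avg Q (u i) epowr \<alpha> i)"
    using split[of "\<lambda>f a. avg _ f epowr a"] by simp
  also have "\<dots> < \<infinity> \<longleftrightarrow> (\<forall>i\<in>{0..m}. u i \<in> A_infinity)"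
  proof (rule prod_avg_bounded_iff_A_infinity)
    show "2 \<le> card {0..m}"
      using assms(1) by simp
    show "0 < \<alpha> i" if "i \<in> {0..m}" for i
      using that assms(2)[of i] \<open>0 < p\<close> by (auto simp: \<alpha>_def conj_exp_def)
    show "weight (u i)" if "i \<in> {0..m}" for i
    proof (cases "i = 0")
      case True
      have "weight (\<lambda>x. \<Prod>i = 1..m. ws i x epowr (p / ps i))"
        by (intro weight_prod weight_epowr assms(4)) auto
      moreover have "w = (\<lambda>x. \<Prod>i = 1..m. ws i x epowr (p / ps i))"
        using assms(5) by (rule ext)
      ultimately show ?thesis
        using True by (simp add: u_def)
    next
      case False
      with that have "i \<in> {1..m}"
        by auto
      then show ?thesis
        using False assms(4) by (simp add: u_def \<sigma>_eq weight_epowr)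
    qed
    have "AE x in lebesgue. \<forall>i\<in>{1..m}. 0 < ws i x \<and> ws i x < \<infinity>"
      using assms(4) by (simp add: AE_finite_all weight_def)
    then show "AE x in lebesgue. (\<Prod>i = 0..m. u i x epowr \<alpha> i) = 1"
    proof eventually_elim
      case (elim x)
      have "(\<Prod>i = 0..m. u i x epowr \<alpha> i)
          = w x epowr (1 / p) * (\<Prod>i = 1..m. \<sigma> i x epowr (1 / conj_exp (ps i)))"
        by (rule split)
      also have "w x epowr (1 / p) = (\<Prod>i = 1..m. ws i x epowr (1 / ps i))"
        using \<open>0 < p\<close> by (simp add: assms(5) epowr_prod epowr_epowr)
      also have "(\<Prod>i = 1..m. \<sigma> i x epowr (1 / conj_exp (ps i))) = (\<Prod>i = 1..m. ws i x epowr (- (1 / ps i)))"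
      proof (rule prod.cong)
        fix i assume i: "i \<in> {1..m}"
        have "(1 - conj_exp (ps i)) * (1 / conj_exp (ps i)) = - (1 / ps i)"
          using assms(2)[OF i] by (simp add: conj_exp_def field_simps)
        then show "\<sigma> i x epowr (1 / conj_exp (ps i)) = ws i x epowr (- (1 / ps i))"
          by (simp only: assms(6)[OF i] epowr_epowr)
      qed simp
      also have "(\<Prod>i = 1..m. ws i x epowr (1 / ps i)) * (\<Prod>i = 1..m. ws i x epowr (- (1 / ps i))) = 1"
        using elim by (simp flip: prod.distrib epowr_add)
      finally show ?case .
    qed
  qed simp
  also have "\<dots> \<longleftrightarrow> w \<in> A_infinity \<and> (\<forall>i \<in> {1..m}. \<sigma> i \<in> A_infinity)"
    unfolding index by (auto simp: u_def)
  finally show ?thesis .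
qed

end
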